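(* Let $\mathcal{H}$ be a reproducing kernel Hilbert space of functions $f:X\to\mathbb{R}$ with reproducing kernel $K:X\times X\to\mathbb{R}$, let $\lambda>0$, let $(\boldsymbol{x}_1,y_1),\dots,(\boldsymbol{x}_N,y_N)\in X\times Y$ be training data, and let $L:X\times Y\times\mathbb{R}\to[0,\infty)$ be a loss function. If $L$ is lower semi-continuous (that is, $L(\boldsymbol{x},y,\cdot)$ is lower semi-continuous on $\mathbb{R}$ for all $\boldsymbol{x}\in X$ and $y\in Y$), then the optimization problem $$\inf_{f\in\mathcal{H}}\ \frac1N\sum_{i=1}^N L(\boldsymbol{x}_i,y_i,f(\boldsymbol{x}_i))+\lambda\|f\|_{\mathcal{H}}^2$$ has a minimizer $f_D\in\mathcal{H}$ such that $$f_D\in\mathrm{span}\{K(\boldsymbol{x}_1,\cdot),\dots,K(\boldsymbol{x}_N,\cdot)\}.$$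
   Context: $X\subseteq\mathbb{R}^d$ is the sample space, $Y=\{+1,-1\}$ is the label space, and $N$ is a positive integer. A reproducing kernel Hilbert space $\mathcal{H}$ with reproducing kernel $K$ is a real Hilbert space of functions $f:X\to\mathbb{R}$ with inner product $\langle\cdot,\cdot\rangle_{\mathcal{H}}$ and norm $\|f\|_{\mathcal{H}}=\sqrt{\langle f,f\rangle_{\mathcal{H}}}$ such that (i) $K(\boldsymbol{x},\cdot)\in\mathcal{H}$ for all $\boldsymbol{x}\in X$, and (ii) $f(\boldsymbol{x})=\langle f,K(\boldsymbol{x},\cdot)\rangle_{\mathcal{H}}$ for all $f\in\mathcal{H}$ and all $\boldsymbol{x}\in X$. The span denotes the set of all finite (real) linear combinations. *)

theory Defs
  imports "HOL-Analysis.Analysis" "HOL-Library.Function_Algebras"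
begin

text \<open>Pointwise scalar multiplication, completing the pointwise operations of
  \<^theory>\<open>HOL-Library.Function_Algebras\<close> so that \<^const>\<open>subspace\<close> and \<^const>\<open>span\<close>
  apply to sets of functions.\<close>

instantiation "fun" :: (type, real_vector) real_vector
begin

definition scaleR_fun :: "real \<Rightarrow> ('a \<Rightarrow> 'b) \<Rightarrow> 'a \<Rightarrow> 'b" where
  "c *\<^sub>R f = (\<lambda>x. c *\<^sub>R f x)"

instance
  by standard (auto simp: scaleR_fun_def fun_eq_iff scaleR_add_right scaleR_add_left)

end

text \<open>A function \<open>X \<rightarrow> \<real>\<close> is represented by the total function that extends it by \<open>0\<close>
  outside \<open>X\<close>; this is a linear bijection onto the functions vanishing outside \<open>X\<close>.
  The inner product \<open>ip\<close> is only constrained on the carrier \<open>H\<close>.\<close>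

definition ip_norm :: "('v \<Rightarrow> 'v \<Rightarrow> real) \<Rightarrow> 'v \<Rightarrow> real" where
  "ip_norm ip f = sqrt (ip f f)"

locale function_hilbert_space =
  fixes X :: "'a set"
    and H :: "('a \<Rightarrow> real) set"
    and ip :: "('a \<Rightarrow> real) \<Rightarrow> ('a \<Rightarrow> real) \<Rightarrow> real"
  assumes zero_outside: "\<And>f t. f \<in> H \<Longrightarrow> t \<notin> X \<Longrightarrow> f t = 0"
    and subspace_H: "subspace H"
    and ip_commute: "\<And>f g. f \<in> H \<Longrightarrow> g \<in> H \<Longrightarrow> ip f g = ip g f"
    and ip_add_left:
      "\<And>f g h. f \<in> H \<Longrightarrow> g \<in> H \<Longrightarrow> h \<in> H \<Longrightarrow> ip (f + g) h = ip f h + ip g h"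
    and ip_scaleR_left:
      "\<And>c f g. f \<in> H \<Longrightarrow> g \<in> H \<Longrightarrow> ip (c *\<^sub>R f) g = c * ip f g"
    and ip_ge_zero: "\<And>f. f \<in> H \<Longrightarrow> 0 \<le> ip f f"
    and ip_eq_zero_iff: "\<And>f. f \<in> H \<Longrightarrow> ip f f = 0 \<longleftrightarrow> f = 0"
    and complete_H:
      "\<And>s :: nat \<Rightarrow> 'a \<Rightarrow> real. (\<And>n. s n \<in> H) \<Longrightarrow>
        (\<And>e. e > 0 \<Longrightarrow> \<exists>M. \<forall>m\<ge>M. \<forall>n\<ge>M. ip_norm ip (s m - s n) < e) \<Longrightarrow>
        \<exists>f\<in>H. (\<lambda>n. ip_norm ip (s n - f)) \<longlonglongrightarrow> 0"

text \<open>The section \<open>K(t, \<cdot>)\<close> is \<open>K t\<close>, extended by \<open>0\<close> outside \<open>X\<close> like every member of \<open>H\<close>;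
  the values \<open>K t u\<close> for \<open>t \<notin> X\<close> are irrelevant.\<close>

locale rkhs = function_hilbert_space X H ip
  for X :: "'a set" and H ip +
  fixes K :: "'a \<Rightarrow> 'a \<Rightarrow> real"
  assumes kernel_mem: "\<And>t. t \<in> X \<Longrightarrow> K t \<in> H"
    and reproducing: "\<And>f t. f \<in> H \<Longrightarrow> t \<in> X \<Longrightarrow> f t = ip f (K t)"

definition labels :: "real set" where
  "labels = {1, - 1}"

definition lower_semicontinuous :: "('a::topological_space \<Rightarrow> real) \<Rightarrow> bool" where
  "lower_semicontinuous g \<longleftrightarrow> (\<forall>t. \<forall>a < g t. \<forall>\<^sub>F s in nhds t. a < g s)"

end

theory Submission
  imports Defs
begin

text \<open>Let \<open>B\<close> be an orthonormal basis of the span of the sections \<open>K (x i)\<close>. The orthogonal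
  projection of \<open>f\<close> onto this span agrees with \<open>f\<close> at every \<open>x i\<close>, because the difference is
  orthogonal to all \<open>K (x i)\<close>, and its norm is at most that of \<open>f\<close>; so it suffices to minimize
  over the span. In coordinates with respect to \<open>B\<close> the objective is lower semicontinuous,
  and outside a cube it exceeds its value at \<open>0\<close>; on the compact cube it attains its minimum.\<close>

section \<open>Lower semicontinuous functions and their minima on compact sets\<close>

lemma lower_semicontinuous_continuous:
  fixes g :: "'a::topological_space \<Rightarrow> real"
  assumes "continuous_on UNIV g"
  shows "lower_semicontinuous g"
  unfolding lower_semicontinuous_def
proof (intro allI impI)
  fix t a assume "a < g t"
  have "(g \<longlongrightarrow> g t) (nhds t)"
    using assms by (simp add: continuous_on_def flip: tendsto_at_iff_tendsto_nhds)
  then show "\<forall>\<^sub>F s in nhds t. a < g s"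
    using \<open>a < g t\<close> by (rule order_tendstoD)
qed

lemma lower_semicontinuous_compose:
  fixes g :: "'b::topological_space \<Rightarrow> real" and h :: "'a::topological_space \<Rightarrow> 'b"
  assumes g: "lower_semicontinuous g" and h: "continuous_on UNIV h"
  shows "lower_semicontinuous (\<lambda>t. g (h t))"
  unfolding lower_semicontinuous_def
proof (intro allI impI)
  fix t a assume "a < g (h t)"
  then have "\<forall>\<^sub>F s in nhds (h t). a < g s"
    using g by (simp add: lower_semicontinuous_def)
  moreover have "(h \<longlongrightarrow> h t) (nhds t)"
    using h by (simp add: continuous_on_def flip: tendsto_at_iff_tendsto_nhds)
  ultimately show "\<forall>\<^sub>F s in nhds t. a < g (h s)"
    by (rule eventually_compose_filterlim)
qed

lemma lower_semicontinuous_add: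
  fixes f g :: "'a::topological_space \<Rightarrow> real"
  assumes f: "lower_semicontinuous f" and g: "lower_semicontinuous g"
  shows "lower_semicontinuous (\<lambda>t. f t + g t)"
  unfolding lower_semicontinuous_def
proof (intro allI impI)
  fix t a assume a: "a < f t + g t"
  \<comment> \<open>Half of the slack goes to each summand, so that the two lowered bounds add up to
    exactly \<open>a\<close>.\<close>
  define d where "d = (f t + g t - a) / 2"
  have d: "d > 0" "a = (f t - d) + (g t - d)"
    using a by (auto simp: d_def field_simps)
  have "\<forall>\<^sub>F s in nhds t. f t - d < f s" "\<forall>\<^sub>F s in nhds t. g t - d < g s"
    using f g d(1) by (auto simp: lower_semicontinuous_def)
  then show "\<forall>\<^sub>F s in nhds t. a < f s + g s"
    by eventually_elim (use d(2) in linarith)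
qed

lemma lower_semicontinuous_sum:
  fixes f :: "'i \<Rightarrow> 'a::topological_space \<Rightarrow> real"
  assumes "\<And>i. i \<in> I \<Longrightarrow> lower_semicontinuous (f i)"
  shows "lower_semicontinuous (\<lambda>t. \<Sum>i\<in>I. f i t)"
  using assms
  by (induction I rule: infinite_finite_induct)
    (auto intro: lower_semicontinuous_add lower_semicontinuous_continuous)

lemma lower_semicontinuous_cmult:
  fixes f :: "'a::topological_space \<Rightarrow> real"
  assumes "lower_semicontinuous f" and "c > 0"
  shows "lower_semicontinuous (\<lambda>t. c * f t)"
proof -
  have "a < c * s \<longleftrightarrow> a / c < s" for a s
    using \<open>c > 0\<close> by (simp add: field_simps)
  with assms(1) show ?thesis
    by (simp add: lower_semicontinuous_def)
qed

text \<open>By lower semicontinuity the strict superlevel sets \<open>{s. g d < g s}\<close> are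
  open. If no point of \<open>C\<close> were minimal, those with \<open>d\<close> in
  \<open>C\<close> would cover \<open>C\<close>. Among the finitely many indices of a subcover, one
  with the least value of \<open>g\<close> lies in none of the covering sets.\<close>

lemma lower_semicontinuous_attains_inf:
  fixes g :: "'a::topological_space \<Rightarrow> real"
  assumes g: "lower_semicontinuous g" and "compact C" and "C \<noteq> {}"
  shows "\<exists>c\<in>C. \<forall>d\<in>C. g c \<le> g d"
proof (rule ccontr)
  assume "\<not> ?thesis"
  then have "C \<subseteq> (\<Union>d\<in>C. {s. g d < g s})"
    by (force simp: not_le)
  moreover have "open {s. a < g s}" for a
    unfolding open_subopen[of "{s. a < g s}"]
    using g by (auto simp: lower_semicontinuous_def eventually_nhds subset_eq)
  ultimately obtain D where D: "D \<subseteq> C" "finite D" "C \<subseteq> (\<Union>d\<in>D. {s. g d < g s})"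
    using compactE_image[OF \<open>compact C\<close>, of C "\<lambda>d. {s. g d < g s}"] by metis
  with \<open>C \<noteq> {}\<close> have "D \<noteq> {}"
    by auto
  then obtain c where c: "c \<in> D" "\<forall>d\<in>D. g c \<le> g d"
    using ex_min_if_finite[of "g ` D"] D(2) by (auto simp: not_less)
  with D show False
    by (force simp: not_less)
qed

text \<open>This is Tychonoff's theorem. Coordinate vectors will be functions on a whole type, so
  the cube may have infinitely many factors, and its topology is the product topology.\<close>

lemma compact_cube: "compact (Pi UNIV (\<lambda>_. {-r..r}) :: ('i \<Rightarrow> real) set)"
  using compactin_PiE[of "\<lambda>_::'i. euclidean::real topology" UNIV "\<lambda>_. {-r..r}"]
  by (simp add: euclidean_product_topology PiE_UNIV_domain Pi_def)

section \<open>Finite linear combinations, orthonormal sets and orthogonal projection\<close>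

lemma sum_scaleR_fun_apply:
  fixes v :: "'i \<Rightarrow> 'a \<Rightarrow> real"
  shows "(\<Sum>i\<in>I. c i *\<^sub>R v i) t = (\<Sum>i\<in>I. c i * v i t)"
  by (induction I rule: infinite_finite_induct) (auto simp: scaleR_fun_def)

context function_hilbert_space
begin

lemma ip_zero_left: "h \<in> H \<Longrightarrow> ip 0 h = 0"
  using ip_scaleR_left[of 0 h 0] subspace_0[OF subspace_H] by simp

lemma ip_sum_left:
  assumes "v ` I \<subseteq> H" and "h \<in> H"
  shows "ip (\<Sum>i\<in>I. c i *\<^sub>R v i) h = (\<Sum>i\<in>I. c i * ip (v i) h)"
  using assms(1)
proof (induction I rule: infinite_finite_induct)
  case (insert i I)
  then have "(\<Sum>i\<in>I. c i *\<^sub>R v i) \<in> H"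
    by (intro subspace_sum[OF subspace_H] subspace_scale[OF subspace_H]) auto
  moreover have v: "v i \<in> H" "v ` I \<subseteq> H"
    using insert.prems by auto
  ultimately show ?case
    unfolding sum.insert[OF insert.hyps]
    by (subst ip_add_left)
      (use v assms(2) insert.IH in \<open>auto simp: ip_scaleR_left subspace_scale[OF subspace_H]\<close>)
qed (use ip_zero_left[OF assms(2)] in auto)

lemma ip_norm_power2: "f \<in> H \<Longrightarrow> (ip_norm ip f)\<^sup>2 = ip f f"
  by (simp add: ip_norm_def ip_ge_zero)

text \<open>Finiteness is included so that sums over \<open>B\<close> are genuine linear
  combinations; \<open>of_bool (a = b)\<close> is the Kronecker delta.\<close>

definition orthonormal_set :: "('a \<Rightarrow> real) set \<Rightarrow> bool" where
  "orthonormal_set B \<longleftrightarrow> finite B \<and> B \<subseteq> H \<and> (\<forall>a\<in>B. \<forall>b\<in>B. ip a b = of_bool (a = b))"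

lemma orthonormal_sum_mem:
  "orthonormal_set B \<Longrightarrow> (\<Sum>b\<in>B. c b *\<^sub>R b) \<in> H"
  by (intro subspace_sum[OF subspace_H] subspace_scale[OF subspace_H]) (auto simp: orthonormal_set_def)

lemma orthonormal_sum_ip_basis:
  assumes B: "orthonormal_set B" and "b \<in> B"
  shows "ip (\<Sum>a\<in>B. c a *\<^sub>R a) b = c b"
proof -
  have "ip (\<Sum>a\<in>B. c a *\<^sub>R a) b = (\<Sum>a\<in>B. c a * ip a b)"
    using assms by (intro ip_sum_left) (auto simp: orthonormal_set_def)
  also have "\<dots> = (\<Sum>a\<in>B. if a = b then c a else 0)"
    using assms by (intro sum.cong) (auto simp: orthonormal_set_def)
  finally show ?thesis
    using assms by (simp add: orthonormal_set_def)
qed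

text \<open>Parseval's identity: pairing the sum with a basis element returns its coefficient. It
  turns the norm penalty into a polynomial in the coordinates.\<close>

lemma orthonormal_sum_norm:
  assumes B: "orthonormal_set B"
  shows "ip (\<Sum>b\<in>B. c b *\<^sub>R b) (\<Sum>b\<in>B. c b *\<^sub>R b) = (\<Sum>b\<in>B. (c b)\<^sup>2)"
proof -
  let ?s = "\<Sum>b\<in>B. c b *\<^sub>R b"
  have "ip ?s ?s = (\<Sum>b\<in>B. c b * ip b ?s)"
    using B orthonormal_sum_mem[OF B] by (intro ip_sum_left) (auto simp: orthonormal_set_def)
  also have "\<dots> = (\<Sum>b\<in>B. (c b)\<^sup>2)"
  proof (intro sum.cong refl)
    fix b assume "b \<in> B"
    then have "ip b ?s = c b"
      using B orthonormal_sum_ip_basis[OF B] ip_commute[OF _ orthonormal_sum_mem[OF B]]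
      by (auto simp: orthonormal_set_def)
    then show "c b * ip b ?s = (c b)\<^sup>2"
      by (simp add: power2_eq_square)
  qed
  finally show ?thesis .
qed

text \<open>The members of \<open>H\<close> orthogonal to \<open>q\<close> form a subspace, which
  contains \<open>span S\<close> as soon as it contains \<open>S\<close>. In the proof
  \<open>q\<close> stands in the second slot, where linearity in the first slot applies
  directly.\<close>

lemma ip_zero_on_span:
  assumes "S \<subseteq> H" "q \<in> H" and "\<And>s. s \<in> S \<Longrightarrow> ip q s = 0" and "k \<in> span S"
  shows "ip q k = 0"
proof -
  have "span S \<subseteq> {h \<in> H. ip h q = 0}"
  proof (rule span_minimal)
    show "S \<subseteq> {h \<in> H. ip h q = 0}"
      using assms ip_commute by fastforce
    show "subspace {h \<in> H. ip h q = 0}"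
      using subspace_H assms(2) unfolding subspace_def
      by (auto simp: ip_zero_left ip_add_left ip_scaleR_left)
  qed
  with assms ip_commute show ?thesis
    by fastforce
qed

lemma diff_mem: "f \<in> H \<Longrightarrow> g \<in> H \<Longrightarrow> f - g \<in> H"
  by (rule subspace_diff[OF subspace_H])

lemma ip_diff_left:
  assumes "f \<in> H" "g \<in> H" "h \<in> H"
  shows "ip (f - g) h = ip f h - ip g h"
  using ip_add_left[OF diff_mem[OF assms(1,2)] assms(2,3)] by simp

text \<open>The coefficient \<open>ip f b\<close> is exactly what cancels the component of
  \<open>f\<close> along \<open>b\<close>, so the residual is orthogonal to each basis element and
  hence to their span.\<close>

lemma orthogonal_residual:
  assumes B: "orthonormal_set B" and f: "f \<in> H" and k: "k \<in> span B"
  shows "ip (f - (\<Sum>b\<in>B. ip f b *\<^sub>R b)) k = 0"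
proof (rule ip_zero_on_span[OF _ _ _ k])
  show "B \<subseteq> H"
    using B by (simp add: orthonormal_set_def)
  show "f - (\<Sum>b\<in>B. ip f b *\<^sub>R b) \<in> H"
    by (rule diff_mem[OF f orthonormal_sum_mem[OF B]])
  show "ip (f - (\<Sum>b\<in>B. ip f b *\<^sub>R b)) s = 0" if "s \<in> B" for s
    using that f B orthonormal_sum_mem[OF B] orthonormal_sum_ip_basis[OF B that]
    by (subst ip_diff_left) (auto simp: orthonormal_set_def)
qed

text \<open>Gram-Schmidt: each new vector \<open>a\<close> is replaced by its residual
  \<open>u\<close> after projection onto the span reached so far. A zero residual adds nothing to
  the span; a nonzero one is normalized and joined to the basis.\<close>

lemma orthonormal_basis_exists:
  assumes "finite S" "S \<subseteq> H"
  shows "\<exists>B. orthonormal_set B \<and> span B = span S"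
  using assms
proof (induction S rule: finite_induct)
  case empty
  show ?case
    by (intro exI[of _ "{}"]) (simp add: orthonormal_set_def)
next
  case (insert a S)
  then obtain B where B: "orthonormal_set B" and span_B: "span B = span S"
    by auto
  have a: "a \<in> H" and BH: "B \<subseteq> H"
    using insert B by (auto simp: orthonormal_set_def)
  define p where "p = (\<Sum>b\<in>B. ip a b *\<^sub>R b)"
  define u where "u = a - p"
  have p: "p \<in> span B"
    unfolding p_def by (intro span_sum span_scale span_base)
  have u: "u \<in> H"
    unfolding u_def p_def by (rule diff_mem[OF a orthonormal_sum_mem[OF B]])
  have span_a: "span (insert u B) = span (insert a S)"
  proof -
    have "span (insert u B) = span (insert a B)"
      using p by (intro eq_span_insert_eq[symmetric]) (simp add: u_def)
    also have "\<dots> = span (insert a S)"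
      by (simp only: span_insert span_B)
    finally show ?thesis .
  qed
  show ?case
  proof (cases "u = 0")
    case True
    then have "span B = span (insert a S)"
      using span_a by simp
    with B show ?thesis
      by blast
  next
    case False
    define n where "n = sqrt (ip u u)"
    have n: "n > 0" "ip u u = n * n"
      using False ip_eq_zero_iff[OF u] ip_ge_zero[OF u] by (auto simp: n_def)
    define e where "e = (1 / n) *\<^sub>R u"
    have e: "e \<in> H"
      unfolding e_def by (rule subspace_scale[OF subspace_H u])
    have ortho: "ip e b = 0" "ip b e = 0" if "b \<in> B" for b
    proof -
      have "ip u b = 0"
        unfolding u_def p_def using that by (intro orthogonal_residual[OF B a] span_base)
      then show "ip e b = 0"
        using that BH u by (auto simp: e_def ip_scaleR_left)
      then show "ip b e = 0"
        using ip_commute[of e b] e BH that by auto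
    qed
    have "ip e e = 1"
    proof -
      have "ip e e = (1 / n) * ip u e"
        using ip_scaleR_left[OF u e] by (simp add: e_def)
      also have "ip u e = (1 / n) * ip u u"
        using ip_scaleR_left[OF u u] ip_commute[OF u e] by (simp add: e_def)
      finally show ?thesis
        using n by simp
    qed
    \<comment> \<open>Membership in \<open>B\<close> would make \<open>e\<close> orthogonal to
      itself, against \<open>ip e e = 1\<close>.\<close>
    moreover from this have "e \<notin> B"
      using ortho by fastforce
    ultimately have "orthonormal_set (insert e B)"
      using B e ortho by (auto simp: orthonormal_set_def)
    moreover have "span (insert e B) = span (insert a S)"
    proof -
      have "u = n *\<^sub>R e"
        using n by (simp add: e_def)
      then have "u \<in> span (insert e B)"
        by (simp add: span_base span_scale)
      moreover have "e \<in> span (insert u B)"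
        by (simp add: e_def span_base span_scale)
      ultimately have "span (insert e B) = span (insert u B)"
        by (intro subset_antisym span_minimal subspace_span) (auto intro: span_base)
      with span_a show ?thesis
        by simp
    qed
    ultimately show ?thesis
      by blast
  qed
qed

end

section \<open>Existence of a minimizer in the span of the kernel sections\<close>

theorem proposition3p1:
  fixes X :: "(real ^ 'd) set"
    and H :: "(real ^ 'd \<Rightarrow> real) set"
    and ip :: "(real ^ 'd \<Rightarrow> real) \<Rightarrow> (real ^ 'd \<Rightarrow> real) \<Rightarrow> real"
    and K :: "real ^ 'd \<Rightarrow> real ^ 'd \<Rightarrow> real"
    and lam :: real
    and N :: nat
    and x :: "nat \<Rightarrow> real ^ 'd"
    and y :: "nat \<Rightarrow> real"
    and L :: "real ^ 'd \<Rightarrow> real \<Rightarrow> real \<Rightarrow> real"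
  assumes "rkhs X H ip K"
    and "lam > 0"
    and "N > 0"
    and "\<And>i. i \<in> {1..N} \<Longrightarrow> x i \<in> X"
    and "\<And>i. i \<in> {1..N} \<Longrightarrow> y i \<in> labels"
    and "\<And>u v t. u \<in> X \<Longrightarrow> v \<in> labels \<Longrightarrow> 0 \<le> L u v t"
    and "\<And>u v. u \<in> X \<Longrightarrow> v \<in> labels \<Longrightarrow> lower_semicontinuous (L u v)"
  shows "\<exists>f\<^sub>D. is_arg_min
            (\<lambda>f. (1 / real N) * (\<Sum>i = 1..N. L (x i) (y i) (f (x i))) + lam * (ip_norm ip f)\<^sup>2)
            (\<lambda>f. f \<in> H) f\<^sub>D
          \<and> f\<^sub>D \<in> span ((\<lambda>i. K (x i)) ` {1..N})"
proof -
  interpret rkhs X H ip K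
    by fact
  let ?F = "\<lambda>f. (1 / real N) * (\<Sum>i = 1..N. L (x i) (y i) (f (x i))) + lam * (ip_norm ip f)\<^sup>2"
  let ?S = "(\<lambda>i. K (x i)) ` {1..N}"
  obtain B where B: "orthonormal_set B" and span_B: "span B = span ?S"
    using orthonormal_basis_exists[of ?S] kernel_mem assms(4)
    by (metis finite_atLeastAtMost finite_imageI image_subsetI)
  \<comment> \<open>Only the coordinates in \<open>B\<close> enter, but \<open>c\<close> is a
    function on the whole type, so that the product topology and the compact cube are
    available.\<close>
  define \<Phi> where "\<Phi> c = (\<Sum>b\<in>B. c b *\<^sub>R b)" for c
  have \<Phi>_mem: "\<Phi> c \<in> H" for c
    unfolding \<Phi>_def by (rule orthonormal_sum_mem[OF B])
  define G where "G c = ?F (\<Phi> c)" for c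
  \<comment> \<open>In this form each prediction and the penalty are continuous in \<open>c\<close>,
    being polynomials in finitely many coordinates; only \<open>L\<close> is merely lower
    semicontinuous.\<close>
  have G_eq: "G c = (1 / real N) * (\<Sum>i = 1..N. L (x i) (y i) (\<Sum>b\<in>B. c b * b (x i)))
      + lam * (\<Sum>b\<in>B. (c b)\<^sup>2)" for c
    using \<Phi>_mem[of c] orthonormal_sum_norm[OF B, of c]
    by (simp add: G_def ip_norm_power2 \<Phi>_def sum_scaleR_fun_apply)
  have lsc: "lower_semicontinuous G"
  proof -
    have "lower_semicontinuous (\<lambda>c. L (x i) (y i) (\<Sum>b\<in>B. c b * b (x i)))"
      if i: "i \<in> {1..N}" for i
    proof (rule lower_semicontinuous_compose[where g = "L (x i) (y i)"])
      show "lower_semicontinuous (L (x i) (y i))"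
        using assms(4,5,7) i by blast
      show "continuous_on UNIV (\<lambda>c. \<Sum>b\<in>B. c b * b (x i))"
        by (intro continuous_on_sum continuous_on_mult_right continuous_on_product_coordinates)
    qed
    then have "lower_semicontinuous (\<lambda>c. \<Sum>i = 1..N. L (x i) (y i) (\<Sum>b\<in>B. c b * b (x i)))"
      by (rule lower_semicontinuous_sum)
    then have "lower_semicontinuous
        (\<lambda>c. (1 / real N) * (\<Sum>i = 1..N. L (x i) (y i) (\<Sum>b\<in>B. c b * b (x i))))"
      by (rule lower_semicontinuous_cmult) (use \<open>N > 0\<close> in simp)
    moreover have "continuous_on UNIV (\<lambda>c. lam * (\<Sum>b\<in>B. (c b)\<^sup>2))"
      by (intro continuous_on_mult_left continuous_on_sum continuous_on_power
          continuous_on_product_coordinates)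
    then have "lower_semicontinuous (\<lambda>c. lam * (\<Sum>b\<in>B. (c b)\<^sup>2))"
      by (rule lower_semicontinuous_continuous)
    ultimately show ?thesis
      unfolding G_eq[abs_def] by (rule lower_semicontinuous_add)
  qed
  \<comment> \<open>The radius solves \<open>lam * r\<^sup>2 = G 0\<close>: one coordinate in
    \<open>B\<close> beyond \<open>r\<close> makes the penalty alone at least \<open>G 0\<close>,
    and the loss term is nonnegative.\<close>
  define r where "r = sqrt (G 0 / lam)"
  have loss_nonneg: "0 \<le> (1 / real N) * (\<Sum>i = 1..N. L (x i) (y i) (f (x i)))" for f
    using assms by (intro mult_nonneg_nonneg sum_nonneg) auto
  have G0: "0 \<le> G 0"
    using loss_nonneg[of "\<Phi> 0"] \<open>lam > 0\<close> by (simp add: G_def)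
  \<comment> \<open>This makes the cube nonempty and later gives \<open>G c \<le> G 0\<close>, the
    bridge to points outside the cube.\<close>
  have zero_mem: "(0 :: (real ^ 'd \<Rightarrow> real) \<Rightarrow> real) \<in> Pi UNIV (\<lambda>_. {-r..r})"
    using G0 \<open>lam > 0\<close> by (auto simp: r_def)
  then obtain c where c: "\<And>d. d \<in> Pi UNIV (\<lambda>_. {-r..r}) \<Longrightarrow> G c \<le> G d"
    using lower_semicontinuous_attains_inf[OF lsc compact_cube] by blast
  \<comment> \<open>Coordinates outside \<open>B\<close> do not change \<open>G\<close> but could
    take \<open>d\<close> out of the cube; with these set to zero, only those in \<open>B\<close>
    have to be compared with \<open>r\<close>.\<close>
  have min: "G c \<le> G d" if outside: "\<And>b. b \<notin> B \<Longrightarrow> d b = 0" for d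
  proof (cases "\<forall>b\<in>B. \<bar>d b\<bar> \<le> r")
    case True
    have "\<bar>d b\<bar> \<le> r" for b
      using True outside[of b] G0 \<open>lam > 0\<close> by (cases "b \<in> B") (auto simp: r_def)
    then show ?thesis
      by (intro c) (auto simp: abs_le_iff minus_le_iff)
  next
    case False
    then obtain b where b: "b \<in> B" "r < \<bar>d b\<bar>"
      by (auto simp: not_le)
    have "G 0 / lam = r\<^sup>2"
      using G0 \<open>lam > 0\<close> by (simp add: r_def)
    also have "\<dots> \<le> \<bar>d b\<bar>\<^sup>2"
      using b G0 \<open>lam > 0\<close> by (intro power_mono) (auto simp: r_def)
    also have "\<dots> \<le> (\<Sum>b\<in>B. (d b)\<^sup>2)"
      using b B by (simp add: member_le_sum[of b B "\<lambda>b. (d b)\<^sup>2"] orthonormal_set_def)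
    finally have "G 0 \<le> lam * (\<Sum>b\<in>B. (d b)\<^sup>2)"
      using \<open>lam > 0\<close> by (simp add: field_simps)
    also have "\<dots> \<le> G d"
      using loss_nonneg[of "\<Phi> d"] by (simp add: G_eq \<Phi>_def sum_scaleR_fun_apply)
    finally show ?thesis
      using c[OF zero_mem] by linarith
  qed
  have "?F (\<Phi> c) \<le> ?F f" if f: "f \<in> H" for f
  proof -
    \<comment> \<open>These are the coordinates of the orthogonal projection of \<open>f\<close>,
      padded with zeros as \<open>min\<close> requires.\<close>
    define d where "d b = (if b \<in> B then ip f b else 0)" for b
    have \<Phi>_d: "\<Phi> d = (\<Sum>b\<in>B. ip f b *\<^sub>R b)"
      by (simp add: \<Phi>_def d_def cong: sum.cong)
    define q where "q = f - \<Phi> d"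
    have q: "q \<in> H"
      unfolding q_def by (rule diff_mem[OF f \<Phi>_mem])
    have q_orth: "ip q k = 0" if "k \<in> span B" for k
      unfolding q_def \<Phi>_d by (rule orthogonal_residual[OF B f that])
    have eval: "\<Phi> d (x i) = f (x i)" if "i \<in> {1..N}" for i
    proof -
      \<comment> \<open>The reproducing property turns orthogonality to \<open>K (x i)\<close> into
        vanishing at \<open>x i\<close>.\<close>
      have "q (x i) = ip q (K (x i))"
        using reproducing q assms(4) that by blast
      also have "\<dots> = 0"
        using that by (intro q_orth) (auto simp: span_B intro: span_base)
      finally show ?thesis
        by (simp add: q_def)
    qed
    have "ip (\<Phi> d) (\<Phi> d) \<le> ip f f"
    proof -
      have q\<Phi>: "ip q (\<Phi> d) = 0"
        unfolding \<Phi>_def by (intro q_orth span_sum span_scale span_base)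
      have split: "ip f h = ip (\<Phi> d) h + ip q h" if "h \<in> H" for h
        using ip_add_left[OF \<Phi>_mem q that, of d] by (simp add: q_def)
      \<comment> \<open>Pythagoras for \<open>f = \<Phi> d + q\<close>: additivity in the first slot
        is used against \<open>f\<close>, \<open>\<Phi> d\<close> and \<open>q\<close>, and symmetry
        exchanges the slots in the mixed terms.\<close>
      have "ip f f = ip (\<Phi> d) (\<Phi> d) + ip q q"
        using split[OF f] split[OF \<Phi>_mem[of d]] split[OF q] q\<Phi>
          ip_commute[OF f q] ip_commute[OF f \<Phi>_mem[of d]] ip_commute[OF q \<Phi>_mem[of d]]
        by linarith
      then show ?thesis
        using ip_ge_zero[OF q] by linarith
    qed
    then have "G d \<le> ?F f"
      using \<open>lam > 0\<close> f \<Phi>_mem eval by (simp add: G_def ip_norm_power2)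
    moreover have "G c \<le> G d"
      by (rule min) (simp add: d_def)
    ultimately show ?thesis
      by (simp add: G_def)
  qed
  moreover have "\<Phi> c \<in> span ?S"
    unfolding \<Phi>_def span_B[symmetric] by (intro span_sum span_scale span_base)
  ultimately show ?thesis
    using \<Phi>_mem by (intro exI[of _ "\<Phi> c"]) (auto simp: is_arg_min_linorder)
qed

end
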